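(* Let $X$ be a Banach space. Suppose that $X^{**}$ contains a reflexive uncomplemented subspace $Y$ which is isomorphic to a complemented subspace $Z$ of $X$ and is such that $\delta(Y,X)>0$. Then $X$ does not have the TPBA.
   Context: A Banach space $X$ is identified with its canonical image in $X^{**}$. For subspaces $U,V$ of a Banach space, the inclination of $U$ to $V$ is $\delta(U,V)=\inf\{\|u-v\|: u\in S(U),\ v\in V\}$, where $S(U)$ is the unit sphere of $U$. "Uncomplemented" for $Y$ means not complemented in $X^{**}$. A subspace $M\subset X^*$ is norming if there exists $c>0$ such that $\sup_{0\ne f\in M}|f(x)|/\|f\|\ge c\|x\|$ for all $x\in X$. A subspace $M\subset X^*$ is quasibasic if there exists a sequence of continuous finite-dimensional (i.e. finite-rank) linear operators $v_n:X\to X$ such that $\lim_{n\to\infty}\|v_n(x)-x\|=0$ for all $x\in X$, and $\mathrm{im}(v_n^* )\subset M$ for all $n$, where $v_n^*$ is the adjoint of $v_n$. A Banach space $X$ has the total property of bounded approximation (TPBA) if every norming subspace $M$ of $X^*$ is quasibasic. *)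

theory Defs
  imports "HOL-Analysis.Analysis"
begin

text \<open>
  Scalars are real. The dual of a space of type \<open>'a\<close> is the type \<open>'a \<Rightarrow>\<^sub>L real\<close>.
  As usual in Banach space theory, a subspace of a Banach space is a closed linear subspace;
  it is a set, and functions on it are only constrained on that set.
\<close>

definition closed_subspace :: "'a::real_normed_vector set \<Rightarrow> bool" where
  "closed_subspace S \<longleftrightarrow> subspace S \<and> closed S"

lift_definition canonical_embedding :: "'a::real_normed_vector \<Rightarrow> (('a \<Rightarrow>\<^sub>L real) \<Rightarrow>\<^sub>L real)"
  is "\<lambda>x f. blinfun_apply f x"
  by (rule blinfun.bounded_linear_left)

text \<open>
  The infimum is taken in \<open>real\<close>, so the value is meaningful only for \<open>U \<noteq> {0}\<close>; the zero
  subspace is always complemented.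
\<close>

definition inclination :: "'a::real_normed_vector set \<Rightarrow> 'a set \<Rightarrow> real" where
  "inclination U V = Inf {norm (u - v) | u v. u \<in> U \<and> norm u = 1 \<and> v \<in> V}"

definition complemented :: "'a::real_normed_vector set \<Rightarrow> bool" where
  "complemented S \<longleftrightarrow> (\<exists>P :: 'a \<Rightarrow>\<^sub>L 'a. P o\<^sub>L P = P \<and> range (blinfun_apply P) = S)"

definition bounded_linear_on ::
    "'a::real_normed_vector set \<Rightarrow> ('a \<Rightarrow> 'b::real_normed_vector) \<Rightarrow> bool" where
  "bounded_linear_on S f \<longleftrightarrow>
     (\<forall>x\<in>S. \<forall>y\<in>S. f (x + y) = f x + f y) \<and>
     (\<forall>c. \<forall>x\<in>S. f (c *\<^sub>R x) = c *\<^sub>R f x) \<and>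
     (\<exists>K. \<forall>x\<in>S. norm (f x) \<le> norm x * K)"

definition isomorphic_subspaces ::
    "'a::real_normed_vector set \<Rightarrow> 'b::real_normed_vector set \<Rightarrow> bool" where
  "isomorphic_subspaces S T \<longleftrightarrow>
     (\<exists>f. bij_betw f S T \<and> bounded_linear_on S f \<and> bounded_linear_on T (inv_into S f))"

text \<open>
  The dual of a subspace \<open>S\<close>, regarded as a normed space in its own right. A functional on \<open>S\<close>
  is represented by its extension by \<open>0\<close> to the whole type, which makes the representation
  unique and compatible with pointwise operations.
\<close>

definition subspace_dual :: "'a::real_normed_vector set \<Rightarrow> ('a \<Rightarrow> real) set" where
  "subspace_dual S = {f. bounded_linear_on S f \<and> (\<forall>x. x \<notin> S \<longrightarrow> f x = 0)}"

definition subspace_dual_norm :: "'a::real_normed_vector set \<Rightarrow> ('a \<Rightarrow> real) \<Rightarrow> real" where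
  "subspace_dual_norm S f = (SUP x\<in>{x \<in> S. norm x \<le> 1}. \<bar>f x\<bar>)"

definition subspace_bidual :: "'a::real_normed_vector set \<Rightarrow> (('a \<Rightarrow> real) \<Rightarrow> real) set" where
  "subspace_bidual S = {F.
     (\<forall>f\<in>subspace_dual S. \<forall>g\<in>subspace_dual S. F (\<lambda>x. f x + g x) = F f + F g) \<and>
     (\<forall>c. \<forall>f\<in>subspace_dual S. F (\<lambda>x. c * f x) = c * F f) \<and>
     (\<exists>K. \<forall>f\<in>subspace_dual S. \<bar>F f\<bar> \<le> subspace_dual_norm S f * K)}"

text \<open>Surjectivity of the canonical map from \<open>S\<close> into the bidual of \<open>S\<close>.\<close>

definition reflexive_subspace :: "'a::real_normed_vector set \<Rightarrow> bool" where
  "reflexive_subspace S \<longleftrightarrow>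
     (\<forall>F\<in>subspace_bidual S. \<exists>x\<in>S. \<forall>f\<in>subspace_dual S. F f = f x)"

text \<open>
  The supremum is taken in \<open>real\<close>. The set is bounded above by \<open>norm x\<close>, and it is empty only
  for \<open>M = {0}\<close>; then the value does not depend on \<open>x\<close>, so the condition fails on every
  nonzero space, as it should.
\<close>

definition norming :: "('a::real_normed_vector \<Rightarrow>\<^sub>L real) set \<Rightarrow> bool" where
  "norming M \<longleftrightarrow>
     (\<exists>c>0. \<forall>x. (SUP f\<in>{f \<in> M. f \<noteq> 0}. \<bar>blinfun_apply f x\<bar> / norm f) \<ge> c * norm x)"

definition finite_rank :: "('a::real_normed_vector \<Rightarrow>\<^sub>L 'b::real_normed_vector) \<Rightarrow> bool" where
  "finite_rank v \<longleftrightarrow> (\<exists>B. finite B \<and> range (blinfun_apply v) = span B)"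

definition dual_map ::
    "('a::real_normed_vector \<Rightarrow>\<^sub>L 'b::real_normed_vector) \<Rightarrow> ('b \<Rightarrow>\<^sub>L real) \<Rightarrow> ('a \<Rightarrow>\<^sub>L real)" where
  "dual_map v f = f o\<^sub>L v"

definition quasibasic :: "('a::real_normed_vector \<Rightarrow>\<^sub>L real) set \<Rightarrow> bool" where
  "quasibasic M \<longleftrightarrow>
     (\<exists>v :: nat \<Rightarrow> 'a \<Rightarrow>\<^sub>L 'a.
        (\<forall>n. finite_rank (v n)) \<and>
        (\<forall>x. (\<lambda>n. norm (blinfun_apply (v n) x - x)) \<longlonglongrightarrow> 0) \<and>
        (\<forall>n. range (dual_map (v n)) \<subseteq> M))"

text \<open>
  Restricting to closed \<open>M\<close> does not change the property: a dense subspace of a quasibasic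
  subspace is quasibasic, by a small perturbation of the operators.
\<close>

definition TPBA :: "'a::banach itself \<Rightarrow> bool" where
  "TPBA _ \<longleftrightarrow>
     (\<forall>M :: ('a \<Rightarrow>\<^sub>L real) set. closed_subspace M \<and> norming M \<longrightarrow> quasibasic M)"

end

theory Submission
  imports Defs
begin

text \<open>
  Let \<open>P\<close> be a projection onto \<open>Z\<close>, let \<open>T : Z \<rightarrow> Y\<close> be an isomorphism and let
  \<open>M = {f. (T z) f = f z for all z \<in> Z}\<close>, the pre-annihilator of \<open>{T z - z | z \<in> Z}\<close>.

  Since \<open>Y\<close> is inclined to the space, \<open>\<parallel>T z - z + s x\<parallel>\<close> dominates \<open>\<parallel>z\<parallel> + \<bar>s\<bar>\<close>, uniformly over unit
  vectors \<open>x\<close>. As \<open>Z\<close> is reflexive, this says that the adjoint of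
  \<open>f \<mapsto> ((T z - z) f, f x)\<close> with values in \<open>Z\<^sup>* \<times> \<real>\<close> is bounded below. That operator is then
  onto, with constants independent of \<open>x\<close>, and a preimage of \<open>(0, 1)\<close> is a functional in \<open>M\<close>
  which norms \<open>x\<close>.

  If \<open>v\<^sub>n\<close> witnesses that \<open>M\<close> is quasibasic, then \<open>v\<^sub>n\<^sup>*\<^sup>* (T z) = v\<^sub>n z \<longrightarrow> z\<close>. A weak limit point of
  the operators \<open>P\<^sup>*\<^sup>* v\<^sub>n\<^sup>*\<^sup>*\<close>, obtained from a generalized limit on bounded sequences and the
  reflexivity of \<open>Z\<close>, sends \<open>T z\<close> to \<open>z\<close>; composed with \<open>T\<close> it projects the bidual onto \<open>Y\<close>.
\<close>

section \<open>The Hahn-Banach theorem\<close>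

definition sublinear :: "('a::real_vector \<Rightarrow> real) \<Rightarrow> bool" where
  "sublinear p \<longleftrightarrow> (\<forall>x y. p (x + y) \<le> p x + p y) \<and> (\<forall>c\<ge>0. \<forall>x. p (c *\<^sub>R x) = c * p x)"

lemma sublinearD:
  assumes "sublinear p"
  shows sublinear_add: "p (x + y) \<le> p x + p y"
    and sublinear_scaleR: "c \<ge> 0 \<Longrightarrow> p (c *\<^sub>R x) = c * p x"
  using assms by (auto simp: sublinear_def)

lemma sublinear_zero: "sublinear p \<Longrightarrow> p 0 = 0"
  using sublinear_scaleR[of p 0 0] by simp

lemma sublinear_minus_ge: "sublinear p \<Longrightarrow> - p (- x) \<le> p x"
  using sublinear_add[of p x "- x"] sublinear_zero[of p] by simp

text \<open>Applying the inequality to \<open>inverse c\<close> yields its converse, so one-sided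
  homogeneity for positive scalars suffices.\<close>

lemma sublinearI:
  assumes add: "\<And>x y. p (x + y) \<le> p x + p y"
    and zero: "p 0 = 0"
    and scale: "\<And>c x. c > 0 \<Longrightarrow> p (c *\<^sub>R x) \<le> c * p x"
  shows "sublinear p"
proof -
  have "p (c *\<^sub>R x) = c * p x" if "c > 0" for c x
  proof (rule antisym)
    have "p (inverse c *\<^sub>R (c *\<^sub>R x)) \<le> inverse c * p (c *\<^sub>R x)"
      using that by (intro scale) simp
    then show "c * p x \<le> p (c *\<^sub>R x)"
      using that by (simp add: field_simps)
  qed (use that scale in auto)
  then have "p (c *\<^sub>R x) = c * p x" if "c \<ge> 0" for c x
    using that zero by (cases "c = 0") auto
  then show ?thesis using add by (auto simp: sublinear_def)
qed

lemma sublinear_eq_linearI: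
  assumes p: "sublinear p" and add: "\<And>x y. p (x + y) = p x + p y"
  shows "linear p"
proof (rule linearI)
  show "p (x + y) = p x + p y" for x y by (rule add)
  have neg: "p (- x) = - p x" for x
    using add[of x "- x"] sublinear_zero[OF p] by simp
  show "p (c *\<^sub>R x) = c *\<^sub>R p x" for c x
  proof (cases "c \<ge> 0")
    case False
    then have "p ((- c) *\<^sub>R (- x)) = (- c) * p (- x)"
      by (intro sublinear_scaleR[OF p]) simp
    then show ?thesis by (simp add: neg)
  qed (use sublinear_scaleR[OF p] in auto)
qed

text \<open>
  A sublinear functional which is minimal for the pointwise order agrees with all its
  directional minima, and this forces it to be additive.
\<close>

definition directional_min :: "('a::real_vector \<Rightarrow> real) \<Rightarrow> 'a \<Rightarrow> 'a \<Rightarrow> real" where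
  "directional_min p a x = (INF t\<in>{0..}. p (x + t *\<^sub>R a) - t * p a)"

lemma directional_min_le:
  assumes p: "sublinear p" and "t \<ge> 0"
  shows "directional_min p a x \<le> p (x + t *\<^sub>R a) - t * p a"
proof -
  \<comment> \<open>This lower bound does not depend on \<open>s\<close>, so the infimum over shifts
    is a genuine real infimum.\<close>
  have "- p (- x) \<le> p (x + s *\<^sub>R a) - s * p a" if "s \<ge> 0" for s
    using sublinear_add[OF p, of "x + s *\<^sub>R a" "- x"] sublinear_scaleR[OF p that, of a] by simp
  then have "bdd_below ((\<lambda>s. p (x + s *\<^sub>R a) - s * p a) ` {0..})"
    by (intro bdd_belowI2) auto
  then show ?thesis
    unfolding directional_min_def using assms(2) by (intro cINF_lower) auto
qed

lemma directional_min_greatest: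
  assumes "\<And>t. t \<ge> 0 \<Longrightarrow> r \<le> p (x + t *\<^sub>R a) - t * p a"
  shows "r \<le> directional_min p a x"
  unfolding directional_min_def using assms by (intro cINF_greatest) auto

text \<open>A shift \<open>t\<close> for \<open>x\<close> and a shift \<open>s\<close> for
  \<open>y\<close> combine to the shift \<open>t + s\<close> for \<open>x + y\<close>; subadditivity
  follows by minimizing over \<open>s\<close> and then over \<open>t\<close>. For homogeneity the
  shift is rescaled together with the vector.\<close>

lemma sublinear_directional_min:
  assumes p: "sublinear p"
  shows "sublinear (directional_min p a)"
proof (rule sublinearI)
  fix x y
  have step: "directional_min p a (x + y) \<le> (p (x + t *\<^sub>R a) - t * p a) + (p (y + s *\<^sub>R a) - s * p a)"
    if "t \<ge> 0" "s \<ge> 0" for s t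
  proof -
    have "directional_min p a (x + y) \<le> p ((x + y) + (t + s) *\<^sub>R a) - (t + s) * p a"
      using that by (intro directional_min_le p) auto
    also have "(x + y) + (t + s) *\<^sub>R a = (x + t *\<^sub>R a) + (y + s *\<^sub>R a)"
      by (simp add: algebra_simps)
    also have "p \<dots> \<le> p (x + t *\<^sub>R a) + p (y + s *\<^sub>R a)"
      by (rule sublinear_add[OF p])
    finally show ?thesis by (simp add: algebra_simps)
  qed
  have "directional_min p a (x + y) - (p (x + t *\<^sub>R a) - t * p a) \<le> directional_min p a y" if "t \<ge> 0" for t
    using step[OF that] by (intro directional_min_greatest) (simp add: algebra_simps)
  then have "directional_min p a (x + y) - directional_min p a y \<le> directional_min p a x"
    by (intro directional_min_greatest) (simp add: algebra_simps)
  then show "directional_min p a (x + y) \<le> directional_min p a x + directional_min p a y" by simp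
next
  have "p (0 + t *\<^sub>R a) - t * p a = 0" if "t \<ge> 0" for t
    using sublinear_scaleR[OF p that] by simp
  then show "directional_min p a 0 = 0"
    using directional_min_le[OF p, of 0 a 0] sublinear_zero[OF p]
    by (intro antisym directional_min_greatest) auto
next
  fix c :: real and x :: 'a assume c: "c > 0"
  have "directional_min p a (c *\<^sub>R x) / c \<le> directional_min p a x"
  proof (rule directional_min_greatest)
    fix t :: real assume t: "t \<ge> 0"
    have "directional_min p a (c *\<^sub>R x) \<le> p (c *\<^sub>R x + (c * t) *\<^sub>R a) - (c * t) * p a"
      using c t by (intro directional_min_le p) auto
    also have "c *\<^sub>R x + (c * t) *\<^sub>R a = c *\<^sub>R (x + t *\<^sub>R a)" by (simp add: algebra_simps)
    also have "p \<dots> = c * p (x + t *\<^sub>R a)" using c by (intro sublinear_scaleR[OF p]) simp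
    finally show "directional_min p a (c *\<^sub>R x) / c \<le> p (x + t *\<^sub>R a) - t * p a"
      using c by (simp add: field_simps)
  qed
  then show "directional_min p a (c *\<^sub>R x) \<le> c * directional_min p a x"
    using c by (simp add: field_simps)
qed

text \<open>Of two members of a chain one lies below both, and its subadditivity bounds the infimum
  at \<open>x + y\<close> by \<open>q x + r y\<close>. The common upper bound \<open>p\<close>
  supplies the lower bound \<open>- p (- x)\<close>, which keeps the infima finite.\<close>

lemma sublinear_INF_chain:
  fixes C :: "('a::real_vector \<Rightarrow> real) set"
  assumes "C \<noteq> {}" and sub: "\<And>q. q \<in> C \<Longrightarrow> sublinear q"
    and bdd: "\<And>q x. q \<in> C \<Longrightarrow> q x \<le> p x"
    and chain: "\<And>q r. q \<in> C \<Longrightarrow> r \<in> C \<Longrightarrow> q \<le> r \<or> r \<le> q"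
  shows "sublinear (\<lambda>x. INF q\<in>C. q x)" and "q \<in> C \<Longrightarrow> (INF q\<in>C. q x) \<le> q x"
proof -
  have "- p (- x) \<le> q x" if "q \<in> C" for q x
    using sublinear_minus_ge[OF sub[OF that], of x] bdd[OF that, of "- x"] by simp
  then have "bdd_below ((\<lambda>q. q x) ` C)" for x by (intro bdd_belowI2) auto
  then have lower: "(INF q\<in>C. q x) \<le> q x" if "q \<in> C" for q x
    using that by (intro cINF_lower) auto
  then show "q \<in> C \<Longrightarrow> (INF q\<in>C. q x) \<le> q x" .
  show "sublinear (\<lambda>x. INF q\<in>C. q x)"
  proof (rule sublinearI)
    fix x y
    have step: "(INF q\<in>C. q (x + y)) \<le> q x + r y" if qr: "q \<in> C" "r \<in> C" for q r
    proof -
      obtain s where s: "s \<in> C" "s \<le> q" "s \<le> r"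
        using chain[OF qr] qr by (metis order_refl)
      then have "(INF q\<in>C. q (x + y)) \<le> s x + s y"
        using lower[OF s(1), of "x + y"] sublinear_add[OF sub[OF s(1)], of x y] by linarith
      also have "\<dots> \<le> q x + r y" using s by (auto simp: le_fun_def intro: add_mono)
      finally show ?thesis .
    qed
    have "(INF q\<in>C. q (x + y)) - q x \<le> (INF q\<in>C. q y)" if "q \<in> C" for q
      using step[OF that] assms(1) by (intro cINF_greatest) (auto simp: algebra_simps)
    then have "(INF q\<in>C. q (x + y)) - (INF q\<in>C. q y) \<le> (INF q\<in>C. q x)"
      using assms(1) by (intro cINF_greatest) (auto simp: algebra_simps)
    then show "(INF q\<in>C. q (x + y)) \<le> (INF q\<in>C. q x) + (INF q\<in>C. q y)" by simp
  next
    have "(INF q\<in>C. q 0) = (INF q\<in>C. 0)"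
      using sublinear_zero[OF sub] by (intro INF_cong) auto
    then show "(INF q\<in>C. q 0) = 0" using assms(1) by simp
  next
    fix c :: real and x :: 'a assume c: "c > 0"
    have "(INF q\<in>C. q (c *\<^sub>R x)) / c \<le> (INF q\<in>C. q x)"
    proof (rule cINF_greatest[OF assms(1)])
      fix q assume q: "q \<in> C"
      show "(INF q\<in>C. q (c *\<^sub>R x)) / c \<le> q x"
        using lower[OF q, of "c *\<^sub>R x"] sublinear_scaleR[OF sub[OF q], of c x] c
        by (simp add: field_simps)
    qed
    then show "(INF q\<in>C. q (c *\<^sub>R x)) \<le> c * (INF q\<in>C. q x)"
      using c by (simp add: field_simps)
  qed
qed

lemma ex_linear_below_sublinear:
  assumes p: "sublinear p"
  shows "\<exists>h. linear h \<and> h \<le> p"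
proof -
  define S where "S = {q. sublinear q \<and> q \<le> p}"
  have "\<exists>m\<in>S. \<forall>q\<in>S. q \<le> m \<longrightarrow> q = m"
  \<comment> \<open>The order is reversed, so the maximal element given by Zorn's lemma is a minimal
    sublinear functional below \<open>p\<close>.\<close>
  proof (rule predicate_Zorn[where P = "\<lambda>a b. b \<le> a"])
    show "partial_order_on S (relation_of (\<lambda>a b. b \<le> a) S)"
      by (rule partial_order_on_relation_ofI) auto
    fix C assume C: "C \<in> Chains (relation_of (\<lambda>a b. b \<le> a) S)"
    show "\<exists>u\<in>S. \<forall>a\<in>C. u \<le> a"
    proof (cases "C = {}")
      case True
      then show ?thesis using p by (auto simp: S_def)
    next
      case False
      have CS: "q \<in> S" if "q \<in> C" for q using C that by (auto simp: Chains_def relation_of_def)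
      have chain: "q \<le> r \<or> r \<le> q" if "q \<in> C" "r \<in> C" for q r
        using C that by (auto simp: Chains_def relation_of_def)
      have 1: "sublinear q" and 2: "q x \<le> p x" if "q \<in> C" for q x
        using CS[OF that] by (auto simp: S_def le_fun_def)
      have 3: "(INF q\<in>C. q x) \<le> q x" if "q \<in> C" for q x
        using False 1 2 chain that by (rule sublinear_INF_chain(2)[where p = p])
      obtain q0 where "q0 \<in> C" using False by blast
      then have "(INF q\<in>C. q x) \<le> p x" for x
        using 3[of q0 x] 2[of q0 x] by simp
      moreover have "sublinear (\<lambda>x. INF q\<in>C. q x)"
        using False 1 2 chain by (rule sublinear_INF_chain(1)[where p = p])
      ultimately have "(\<lambda>x. INF q\<in>C. q x) \<in> S" by (simp add: S_def le_fun_def)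
      then show ?thesis using 3 by (intro bexI) (auto simp: le_fun_def)
    qed
  qed
  then obtain m where m: "sublinear m" "m \<le> p"
    and min: "\<And>q. sublinear q \<Longrightarrow> q \<le> p \<Longrightarrow> q \<le> m \<Longrightarrow> q = m"
    by (auto simp: S_def)
  have "m (x + y) = m x + m y" for x y
  proof (rule antisym)
    \<comment> \<open>The shift \<open>t = 0\<close> puts the directional minimum below
      \<open>m\<close>, so minimality makes them equal; the shift \<open>t = 1\<close> then reads
      \<open>m x \<le> m (x + y) - m y\<close>.\<close>
    have le: "directional_min m y \<le> m"
      using directional_min_le[OF m(1), of 0 y] by (simp add: le_fun_def)
    then have "directional_min m y = m"
      using m(2) by (intro min sublinear_directional_min m(1)) (auto intro: order_trans)
    then show "m x + m y \<le> m (x + y)"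
      using directional_min_le[OF m(1), of 1 y x] by simp
  qed (rule sublinear_add[OF m(1)])
  then show ?thesis using sublinear_eq_linearI[OF m(1)] m(2) by blast
qed

text \<open>A linear functional is taken below \<open>directional_min p a\<close> rather than below
  \<open>p\<close>: at \<open>- a\<close> the shift by \<open>a\<close> gives
  \<open>h (- a) \<le> - p a\<close>, which forces \<open>h a = p a\<close>.\<close>

lemma Hahn_Banach_sublinear:
  assumes p: "sublinear p"
  obtains h where "linear h" "\<And>x. h x \<le> p x" "h a = p a"
proof -
  obtain h where h: "linear h" "h \<le> directional_min p a"
    using ex_linear_below_sublinear[OF sublinear_directional_min[OF p]] by blast
  have le: "h x \<le> p (x + t *\<^sub>R a) - t * p a" if "t \<ge> 0" for x t
    using h(2) directional_min_le[OF p that, of a x] by (auto simp: le_fun_def intro: order_trans)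
  have "h x \<le> p x" for x using le[of 0 x] by simp
  moreover have "h a \<ge> p a"
    using le[of 1 "- a"] sublinear_zero[OF p] linear_neg[OF h(1), of a] by simp
  ultimately show ?thesis using that h(1) by (metis antisym)
qed

lemma Hahn_Banach_seminorm:
  fixes p :: "'a::real_vector \<Rightarrow> real"
  assumes p: "sublinear p" and sym: "\<And>x. p (- x) = p x"
  obtains h where "linear h" "\<And>x. \<bar>h x\<bar> \<le> p x" "h a = p a"
proof -
  obtain h where h: "linear h" "\<And>x. h x \<le> p x" "h a = p a"
    using Hahn_Banach_sublinear[OF p] by blast
  have "\<bar>h x\<bar> \<le> p x" for x
    using h(2)[of x] h(2)[of "- x"] sym[of x] linear_neg[OF h(1), of x] by linarith
  with h show ?thesis using that by blast
qed

lemma norming_functional: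
  fixes x :: "'a::real_normed_vector"
  obtains h :: "'a \<Rightarrow>\<^sub>L real" where "norm h \<le> 1" "h x = norm x"
proof -
  have "sublinear (norm :: 'a \<Rightarrow> real)"
    by (rule sublinearI) (auto simp: norm_triangle_ineq)
  then obtain h :: "'a \<Rightarrow> real" where h: "linear h" "\<And>y. \<bar>h y\<bar> \<le> norm y" "h x = norm x"
    by (rule Hahn_Banach_seminorm[of norm x]) auto
  have "bounded_linear h"
    using h(1,2) by (intro bounded_linear_intro[where K = 1]) (auto simp: linear_add linear_scale)
  then have "norm (Blinfun h) \<le> 1" "Blinfun h x = norm x"
    using h(2,3) by (auto intro!: norm_blinfun_bound simp: bounded_linear_Blinfun_apply)
  then show ?thesis using that by blast
qed

section \<open>Generalized limits and uniform boundedness\<close>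

text \<open>\<open>q\<close> is the limit superior, written as the infimum of the eventual upper
  bounds. A linear functional below it has the right value on convergent sequences, because
  \<open>q\<close> bounds it at both \<open>s\<close> and \<open>- s\<close>.\<close>

lemma generalized_limit_exists:
  obtains L :: "(nat \<Rightarrow>\<^sub>C real) \<Rightarrow> real" where
    "linear L" "\<And>s. \<bar>L s\<bar> \<le> norm s" "\<And>s l. apply_bcontfun s \<longlonglongrightarrow> l \<Longrightarrow> L s = l"
proof -
  define U where "U s = {r. \<forall>\<^sub>F n in sequentially. apply_bcontfun s n \<le> r}" for s :: "nat \<Rightarrow>\<^sub>C real"
  define q where "q s = Inf (U s)" for s
  have UI: "r \<in> U s" if "\<forall>\<^sub>F n in sequentially. apply_bcontfun s n \<le> r" for r s
    using that by (simp add: U_def)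
  have abs: "\<bar>apply_bcontfun s n\<bar> \<le> norm s" for s n
    using norm_bounded[of s n] by simp
  have low: "- norm s \<le> r" if "r \<in> U s" for r s
  proof -
    have "\<exists>n. apply_bcontfun s n \<le> r"
      using that eventually_happens'[OF sequentially_bot] unfolding U_def by blast
    then obtain n where "apply_bcontfun s n \<le> r" by blast
    with abs[of s n] show ?thesis by simp
  qed
  then have bdd: "bdd_below (U s)" for s by (rule bdd_belowI)
  have mem: "norm s \<in> U s" for s
    using abs[of s] by (intro UI always_eventually) (meson abs_le_D1)
  then have ne: "U s \<noteq> {}" for s by blast
  have q_le: "q s \<le> r" if "r \<in> U s" for r s
    unfolding q_def using that bdd by (rule cInf_lower)
  have q_ge: "r \<le> q s" if "\<And>t. t \<in> U s \<Longrightarrow> r \<le> t" for r s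
    unfolding q_def using ne that by (rule cInf_greatest)
  have q_lim: "q s \<le> l" if "apply_bcontfun s \<longlonglongrightarrow> l" for s l
  proof (rule field_le_epsilon)
    fix e :: real assume "e > 0"
    then have "\<forall>\<^sub>F n in sequentially. apply_bcontfun s n < l + e"
      using that by (intro order_tendstoD) auto
    then show "q s \<le> l + e" by (intro q_le UI) (auto elim: eventually_mono)
  qed
  have "sublinear q"
  proof (rule sublinearI)
    fix s t
    have "q (s + t) \<le> r + r'" if "r \<in> U s" "r' \<in> U t" for r r'
    proof (intro q_le UI)
      have "\<forall>\<^sub>F n in sequentially. apply_bcontfun s n \<le> r \<and> apply_bcontfun t n \<le> r'"
        using that by (auto simp: U_def intro: eventually_conj)
      then show "\<forall>\<^sub>F n in sequentially. apply_bcontfun (s + t) n \<le> r + r'"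
        by (rule eventually_mono) (simp add: plus_bcontfun.rep_eq)
    qed
    then have "q (s + t) - r \<le> q t" if "r \<in> U s" for r
      using that by (intro q_ge) (metis add.commute diff_le_eq)
    then have "q (s + t) - q t \<le> q s"
      by (intro q_ge) (simp add: algebra_simps)
    then show "q (s + t) \<le> q s + q t" by simp
  next
    have "q 0 \<le> 0" by (rule q_lim) simp
    moreover have "0 \<le> q 0" using low[of _ 0] by (intro q_ge) simp
    ultimately show "q 0 = 0" by simp
  next
    fix c :: real and s assume c: "c > 0"
    have "q (c *\<^sub>R s) / c \<le> q s"
    proof (rule q_ge)
      fix r assume "r \<in> U s"
      then have "c * r \<in> U (c *\<^sub>R s)"
        using c by (auto simp: U_def scaleR_bcontfun.rep_eq elim!: eventually_mono)
      then show "q (c *\<^sub>R s) / c \<le> r" using q_le[of "c * r"] c by (simp add: field_simps)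
    qed
    then show "q (c *\<^sub>R s) \<le> c * q s" using c by (simp add: field_simps)
  qed
  then obtain L where L: "linear L" "\<And>s. L s \<le> q s" using Hahn_Banach_sublinear by blast
  have "L s \<le> norm s" for s using L(2)[of s] q_le[OF mem, of s] by simp
  from this[of "- _"] this have "\<bar>L s\<bar> \<le> norm s" for s
    using linear_neg[OF L(1), of s] by (metis abs_le_iff norm_minus_cancel)
  moreover have "L s = l" if "apply_bcontfun s \<longlonglongrightarrow> l" for s l
  proof -
    have "apply_bcontfun (- s) \<longlonglongrightarrow> - l"
      using that by (simp add: uminus_bcontfun.rep_eq tendsto_minus)
    from q_lim[OF this] q_lim[OF that] show ?thesis
      using L(2)[of s] L(2)[of "- s"] linear_neg[OF L(1), of s] by simp
  qed
  ultimately show ?thesis using that L(1) by blast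
qed

text \<open>Baire category: pointwise boundedness covers the space by the closed sets
  \<open>C m\<close>, so one of them contains a ball. Differences of points of that ball bound the
  operators on all directions.\<close>

lemma uniform_boundedness:
  fixes v :: "nat \<Rightarrow> 'a::banach \<Rightarrow>\<^sub>L 'b::real_normed_vector"
  assumes "\<And>x. bounded (range (\<lambda>n. v n x))"
  obtains B where "\<And>n. norm (v n) \<le> B"
proof -
  define C where "C m = {x. \<forall>n. norm (v n x) \<le> real m}" for m :: nat
  have closed: "closed (C m)" for m
    unfolding C_def by (intro closed_Collect_all closed_Collect_le continuous_intros)
  have "\<exists>m. x \<in> C m" for x
  proof -
    obtain b where "\<And>n. norm (v n x) \<le> b" using assms[of x] by (auto simp: bounded_iff)
    moreover obtain m :: nat where "b \<le> real m" using real_arch_simple by blast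
    ultimately show ?thesis by (auto simp: C_def intro: order_trans)
  qed
  then have union: "\<Union>(range C) = UNIV" by blast
  have "\<exists>m. interior (C m) \<noteq> {}"
  proof (rule ccontr)
    assume "\<not> ?thesis"
    then have int: "interior (C m) = {}" for m by auto
    have "Met_TC.mcomplete TYPE('a)"
      by (simp add: complete_UNIV)
    then have "interior (\<Union>(range C)) = {}"
      using Met_TC.metric_Baire_category_alt[of "range C"] int closed by auto
    then show False using union by simp
  qed
  then obtain m x r where r: "r > 0" "cball x r \<subseteq> C m"
    by (metis ex_in_conv mem_interior_cball)
  have "norm (v n) \<le> 2 * real m / r" for n
  proof (rule norm_blinfun_bound)
    fix y
    show "norm (v n y) \<le> 2 * real m / r * norm y"
    proof (cases "y = 0")
      case False
      \<comment> \<open>This scaling gives \<open>c *\<^sub>R y\<close> norm \<open>r\<close>, so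
        that \<open>x + c *\<^sub>R y\<close> is still in the ball.\<close>
      define c where "c = r / norm y"
      have c: "c > 0" using r False by (simp add: c_def)
      have "x \<in> C m" "x + c *\<^sub>R y \<in> C m"
        using r False by (auto simp: c_def dist_norm intro!: subsetD[OF r(2)])
      then have "norm (v n x) \<le> m" "norm (v n (x + c *\<^sub>R y)) \<le> m" by (auto simp: C_def)
      then have "norm (v n (x + c *\<^sub>R y) - v n x) \<le> 2 * m"
        using norm_triangle_ineq4[of "v n (x + c *\<^sub>R y)" "v n x"] by simp
      then have "c * norm (v n y) \<le> 2 * m"
        using c by (simp add: blinfun.add_right blinfun.scaleR_right)
      then show ?thesis using c r False by (simp add: c_def field_simps)
    qed simp
  qed (use r in auto)
  then show ?thesis using that by blast
qed

section \<open>Operators whose adjoint is bounded below\<close>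

text \<open>The approximate solution is applied again to each residual. The residuals stay in
  \<open>E\<close> and halve at every step, so the corrections form an absolutely convergent series,
  whose geometric sum produces the factor 2.\<close>

lemma approximate_solution_imp_solution:
  fixes A :: "'b::banach \<Rightarrow>\<^sub>L 'c::real_normed_vector"
  assumes E: "subspace E" "range A \<subseteq> E" and K: "K \<ge> 0"
    and approx: "\<And>g. g \<in> E \<Longrightarrow> \<exists>f. norm f \<le> K * norm g \<and> norm (g - A f) \<le> norm g / 2"
    and g: "g \<in> E"
  obtains f where "A f = g" "norm f \<le> 2 * K * norm g"
proof -
  obtain s where s: "\<And>g. g \<in> E \<Longrightarrow> norm (s g) \<le> K * norm g"
    "\<And>g. g \<in> E \<Longrightarrow> norm (g - A (s g)) \<le> norm g / 2"
    using approx by metis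
  define r where "r n = ((\<lambda>g. g - A (s g)) ^^ n) g" for n
  have r_Suc: "r (Suc n) = r n - A (s (r n))" for n by (simp add: r_def)
  have rE: "r n \<in> E" for n
  proof (induction n)
    case (Suc n)
    then show ?case using E by (auto simp: r_Suc intro!: subspace_diff)
  qed (use g in \<open>simp add: r_def\<close>)
  have r_le: "norm (r n) \<le> norm g * (1/2) ^ n" for n
  proof (induction n)
    case (Suc n)
    have "norm (r (Suc n)) \<le> norm (r n) / 2" using s(2)[OF rE] by (simp add: r_Suc)
    with Suc show ?case by simp
  qed (simp add: r_def)
  have bound: "norm (s (r n)) \<le> K * norm g * (1/2) ^ n" for n
    using s(1)[OF rE[of n]] mult_left_mono[OF r_le[of n] K] by (simp add: mult.assoc)
  have geo: "(\<lambda>n. K * norm g * (1/2) ^ n) sums (2 * K * norm g)"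
    using sums_mult[OF geometric_sums[of "1/2 :: real"], of "K * norm g"] by (simp add: mult_ac)
  have sum: "summable (\<lambda>n. s (r n))"
    using bound by (intro summable_comparison_test'[OF sums_summable[OF geo]])
  have "(\<lambda>n. norm g * (1/2) ^ n) \<longlonglongrightarrow> 0"
    by (intro tendsto_mult_right_zero LIMSEQ_power_zero) simp
  then have "r \<longlonglongrightarrow> 0"
    by (rule Lim_null_comparison[OF always_eventually[OF allI[OF r_le]]])
  \<comment> \<open>Each \<open>A (s (r n))\<close> is the drop between consecutive residuals, so
    the images telescope to \<open>r 0 = g\<close>.\<close>
  then have "(\<lambda>n. r n - r (Suc n)) sums (r 0 - 0)"
    by (rule telescope_sums')
  then have "(\<lambda>n. A (s (r n))) sums g"
    by (simp add: r_Suc) (simp add: r_def)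
  moreover have "(\<lambda>n. A (s (r n))) sums A (\<Sum>n. s (r n))"
    using sum by (intro bounded_linear.sums[OF blinfun.bounded_linear_right] summable_sums)
  ultimately have "A (\<Sum>n. s (r n)) = g" by (rule sums_unique2[symmetric])
  moreover have "norm (\<Sum>n. s (r n)) \<le> (\<Sum>n. K * norm g * (1/2) ^ n)"
    using bound sums_summable[OF geo] by (intro norm_suminf_le)
  ultimately show ?thesis using that sums_unique[OF geo] by metis
qed

lemma adjoint_bounded_below_imp_approximate_solution:
  fixes A :: "'b::real_normed_vector \<Rightarrow>\<^sub>L 'c::real_normed_vector"
  assumes K: "K > 0" and below: "\<And>h :: 'c \<Rightarrow>\<^sub>L real. \<bar>blinfun_apply h g\<bar> \<le> K * norm (h o\<^sub>L A) * norm g"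
  shows "\<exists>f. norm f \<le> 2 * K * norm g \<and> norm (g - A f) \<le> norm g / 2"
proof (cases "g = 0")
  case True
  then show ?thesis by (intro exI[of _ 0]) auto
next
  case False
  define m where "m = 4 * K"
  have m: "m > 0" using K by (simp add: m_def)
  \<comment> \<open>A functional attaining this seminorm at \<open>g\<close> satisfies \<open>\<parallel>h \<circ> A\<parallel> \<le> 1\<close>, hence \<open>p g \<le> K * \<parallel>g\<parallel>\<close>;
    the penalty weight \<open>m\<close> then makes a near-minimizer an approximate solution.\<close>
  define p where "p x = (INF f. norm f + m * norm (x - A f))" for x
  have p_le: "p x \<le> norm f + m * norm (x - A f)" for x f
    unfolding p_def using m by (intro cINF_lower bdd_belowI2[where m = 0]) auto
  have p_ge: "r \<le> p x" if "\<And>f. r \<le> norm f + m * norm (x - A f)" for r x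
    unfolding p_def using that by (intro cINF_greatest) auto
  have "sublinear p"
  proof (rule sublinearI)
    fix x y
    have step: "p (x + y) \<le> (norm f + m * norm (x - A f)) + (norm e + m * norm (y - A e))" for e f
    proof -
      have "p (x + y) \<le> norm (f + e) + m * norm ((x + y) - A (f + e))" by (rule p_le)
      also have "(x + y) - A (f + e) = (x - A f) + (y - A e)" by (simp add: blinfun.add_right)
      also have "norm (f + e) + m * norm \<dots> \<le> (norm f + norm e) + m * (norm (x - A f) + norm (y - A e))"
        using m by (intro add_mono mult_left_mono norm_triangle_ineq) auto
      finally show ?thesis by (simp add: algebra_simps)
    qed
    have "p (x + y) - (norm f + m * norm (x - A f)) \<le> p y" for f
      using step[of f] by (intro p_ge) (simp add: algebra_simps)
    then have "p (x + y) - p y \<le> p x" by (intro p_ge) (simp add: algebra_simps)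
    then show "p (x + y) \<le> p x + p y" by simp
  next
    have "p 0 \<le> 0" using p_le[of 0 0] by simp
    moreover have "0 \<le> p 0" using m by (intro p_ge) simp
    ultimately show "p 0 = 0" by simp
  next
    fix c :: real and x assume c: "c > 0"
    have "p (c *\<^sub>R x) / c \<le> p x"
    proof (rule p_ge)
      fix f
      have "p (c *\<^sub>R x) \<le> norm (c *\<^sub>R f) + m * norm (c *\<^sub>R x - A (c *\<^sub>R f))" by (rule p_le)
      also have "c *\<^sub>R x - A (c *\<^sub>R f) = c *\<^sub>R (x - A f)"
        by (simp add: blinfun.scaleR_right scaleR_diff_right)
      also have "norm (c *\<^sub>R f) + m * norm \<dots> = c * (norm f + m * norm (x - A f))"
        using c by (simp add: distrib_left mult.left_commute)
      finally show "p (c *\<^sub>R x) / c \<le> norm f + m * norm (x - A f)"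
        using c by (simp add: field_simps)
    qed
    then show "p (c *\<^sub>R x) \<le> c * p x" using c by (simp add: field_simps)
  qed
  moreover have "p (- x) = p x" for x
  proof -
    have "p (- x) \<le> p x" for x
    proof (rule p_ge)
      fix f
      have "norm (- x - A (- f)) = norm (x - A f)"
        by (metis blinfun.minus_right minus_diff_minus norm_minus_cancel)
      then show "p (- x) \<le> norm f + m * norm (x - A f)"
        using p_le[of "- x" "- f"] by simp
    qed
    from this[of x] this[of "- x"] show ?thesis by simp
  qed
  ultimately obtain h where h: "linear h" "\<And>x. \<bar>h x\<bar> \<le> p x" "h g = p g"
    using Hahn_Banach_seminorm by blast
  have "\<bar>h x\<bar> \<le> norm x * m" for x
    using h(2)[of x] p_le[of x 0] by (simp add: mult.commute)
  then have "bounded_linear h"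
    using h(1) by (intro bounded_linear_intro[where K = m]) (auto simp: linear_add linear_scale)
  then have Bh: "blinfun_apply (Blinfun h) = h" by (rule bounded_linear_Blinfun_apply)
  have "\<bar>h (A f)\<bar> \<le> norm f" for f
    using h(2)[of "A f"] p_le[of "A f" f] by simp
  then have "norm (Blinfun h o\<^sub>L A) \<le> 1"
    by (intro norm_blinfun_bound) (auto simp: Bh)
  then have "K * norm (Blinfun h o\<^sub>L A) * norm g \<le> K * 1 * norm g"
    using K by (intro mult_right_mono mult_left_mono) auto
  then have "p g \<le> K * norm g"
    using below[of "Blinfun h"] h(3) by (simp add: Bh)
  also have "\<dots> < 2 * K * norm g" using K False by simp
  finally have "\<exists>f. norm f + m * norm (g - A f) < 2 * K * norm g"
    using p_ge[of "2 * K * norm g" g] by (meson not_le)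
  then obtain f where f: "norm f + m * norm (g - A f) < 2 * K * norm g" by blast
  have "norm f \<le> 2 * K * norm g"
    using f m by (smt (verit) mult_nonneg_nonneg norm_ge_zero)
  \<comment> \<open>The weight \<open>m = 4 * K\<close> is twice the constant \<open>2 * K\<close>
    of the bound, which leaves exactly half of \<open>norm g\<close>.\<close>
  moreover have "2 * K * (2 * norm (g - A f)) \<le> 2 * K * norm g"
    using f norm_ge_zero[of f] unfolding m_def by linarith
  then have "norm (g - A f) \<le> norm g / 2" using K by simp
  ultimately show ?thesis by blast
qed

text \<open>Quantitative surjectivity onto \<open>E\<close>: duality gives approximate solutions
  with constant \<open>2 * K\<close>, and iteration doubles it. Functionals on the whole codomain
  stand for their restrictions to \<open>E\<close>, since the estimate tests them only on vectors of
  \<open>E\<close>.\<close>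

lemma adjoint_bounded_below_imp_surjective:
  fixes A :: "'b::banach \<Rightarrow>\<^sub>L 'c::real_normed_vector"
  assumes "subspace E" "range A \<subseteq> E" "K > 0" "g \<in> E"
    and "\<And>h :: 'c \<Rightarrow>\<^sub>L real. \<And>g. g \<in> E \<Longrightarrow> \<bar>blinfun_apply h g\<bar> \<le> K * norm (h o\<^sub>L A) * norm g"
  obtains f where "A f = g" "norm f \<le> 4 * K * norm g"
proof -
  have "\<exists>f. norm f \<le> (2 * K) * norm g \<and> norm (g - A f) \<le> norm g / 2" if "g \<in> E" for g
    using adjoint_bounded_below_imp_approximate_solution[OF assms(3,5)] that by simp
  then obtain f where "A f = g" "norm f \<le> 2 * (2 * K) * norm g"
    using approximate_solution_imp_solution[OF assms(1,2) _ _ assms(4), of "2 * K"] assms(3)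
    by (metis less_imp_le mult_pos_pos zero_less_numeral)
  then show ?thesis using that by simp
qed

section \<open>Biduals and reflexivity\<close>

lemma linear_canonical_embedding: "linear canonical_embedding"
  by (intro linearI blinfun_eqI)
    (simp_all add: canonical_embedding.rep_eq blinfun.add_left blinfun.add_right
      blinfun.scaleR_left blinfun.scaleR_right)

lemma norm_canonical_embedding [simp]: "norm (canonical_embedding x) = norm x"
proof (rule antisym)
  have "norm (canonical_embedding x f) \<le> norm x * norm f" for f
    using norm_blinfun[of f x] by (simp add: canonical_embedding.rep_eq mult.commute)
  then show "norm (canonical_embedding x) \<le> norm x"
    by (intro norm_blinfun_bound) auto
  obtain h where h: "norm h \<le> 1" "blinfun_apply h x = norm x" by (rule norming_functional)
  have "norm x \<le> norm (canonical_embedding x) * norm h"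
    using norm_blinfun[of "canonical_embedding x" h] h by (simp add: canonical_embedding.rep_eq)
  also have "\<dots> \<le> norm (canonical_embedding x)" using h(1) by (simp add: mult_left_le)
  finally show "norm x \<le> norm (canonical_embedding x)" .
qed

lemma functionals_separate:
  assumes "\<And>f :: 'a::real_normed_vector \<Rightarrow>\<^sub>L real. f x = f y"
  shows "x = y"
proof -
  obtain h where "norm h \<le> 1" "blinfun_apply h (x - y) = norm (x - y)" by (rule norming_functional)
  then show ?thesis using assms[of h] by (simp add: blinfun.diff_right)
qed

text \<open>Homogeneous form of the inclination: both vectors are divided by \<open>norm u\<close>,
  which keeps them in their subspaces.\<close>

lemma inclination_le:
  assumes "subspace U" "u \<in> U" "subspace V" "v \<in> V"
  shows "inclination U V * norm u \<le> norm (u - v)"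
proof (cases "u = 0")
  case False
  have "inclination U V \<le> norm (u /\<^sub>R norm u - v /\<^sub>R norm u)"
    unfolding inclination_def
  proof (rule cInf_lower)
    show "norm (u /\<^sub>R norm u - v /\<^sub>R norm u) \<in> {norm (u - v) |u v. u \<in> U \<and> norm u = 1 \<and> v \<in> V}"
      using assms False by (intro CollectI exI[of _ "u /\<^sub>R norm u"] exI[of _ "v /\<^sub>R norm u"])
        (auto intro: subspace_scale)
  qed (auto intro!: bdd_belowI[where m = 0])
  also have "\<dots> = norm (u - v) / norm u"
    by (simp flip: scaleR_diff_right add: divide_inverse_commute)
  finally show ?thesis using False by (simp add: field_simps)
qed simp

section \<open>Duals of subspaces and the transfer of reflexivity along an isomorphism\<close>

lemma subspace_dualI:
  assumes "\<And>x y. x \<in> S \<Longrightarrow> y \<in> S \<Longrightarrow> f (x + y) = f x + f y"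
    and "\<And>c x. x \<in> S \<Longrightarrow> f (c *\<^sub>R x) = c * f x"
    and "\<And>x. x \<in> S \<Longrightarrow> \<bar>f x\<bar> \<le> norm x * K"
    and "\<And>x. x \<notin> S \<Longrightarrow> f x = 0"
  shows "f \<in> subspace_dual S"
proof -
  have "bounded_linear_on S f"
    unfolding bounded_linear_on_def
    by (intro conjI ballI allI exI[of _ K]) (use assms(1-3) in auto)
  then show ?thesis using assms(4) by (auto simp: subspace_dual_def)
qed

lemma subspace_dualD:
  assumes "f \<in> subspace_dual S"
  shows "x \<in> S \<Longrightarrow> y \<in> S \<Longrightarrow> f (x + y) = f x + f y"
    and "x \<in> S \<Longrightarrow> f (c *\<^sub>R x) = c * f x" and "x \<notin> S \<Longrightarrow> f x = 0"
  using assms unfolding subspace_dual_def bounded_linear_on_def real_scaleR_def by blast+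

lemma bdd_above_subspace_dual:
  assumes "f \<in> subspace_dual S"
  shows "bdd_above ((\<lambda>x. \<bar>f x\<bar>) ` {x \<in> S. norm x \<le> 1})"
proof -
  obtain K where K: "\<And>x. x \<in> S \<Longrightarrow> \<bar>f x\<bar> \<le> norm x * K"
    using assms unfolding subspace_dual_def bounded_linear_on_def real_norm_def by blast
  have "\<bar>f y\<bar> \<le> \<bar>K\<bar>" if "y \<in> S" "norm y \<le> 1" for y
  proof -
    \<comment> \<open>On a trivial subspace \<open>K\<close> may be negative, hence the absolute
      value.\<close>
    have "norm y * K \<le> norm y * \<bar>K\<bar>" by (simp add: mult_left_mono)
    also have "\<dots> \<le> 1 * \<bar>K\<bar>" using that by (intro mult_right_mono) auto
    finally show ?thesis using K[OF that(1)] by simp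
  qed
  then show ?thesis by (intro bdd_aboveI2) auto
qed

lemma subspace_dual_norm_nonneg:
  assumes "subspace S" "f \<in> subspace_dual S"
  shows "0 \<le> subspace_dual_norm S f"
proof -
  have "\<bar>f 0\<bar> \<le> subspace_dual_norm S f"
    unfolding subspace_dual_norm_def using assms(1)
    by (intro cSUP_upper bdd_above_subspace_dual assms(2)) (auto intro: subspace_0)
  then show ?thesis by simp
qed

lemma subspace_dual_norm_ge:
  assumes "subspace S" "f \<in> subspace_dual S" "x \<in> S"
  shows "\<bar>f x\<bar> \<le> subspace_dual_norm S f * norm x"
proof -
  have scale: "f (c *\<^sub>R x) = c * f x" for c
    using assms(2,3) by (auto simp: subspace_dual_def bounded_linear_on_def)
  show ?thesis
  proof (cases "x = 0")
    case True
    then show ?thesis using scale[of 0] by simp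
  next
    case False
    have "\<bar>f (x /\<^sub>R norm x)\<bar> \<le> subspace_dual_norm S f"
      unfolding subspace_dual_norm_def using assms(1,3) False
      by (intro cSUP_upper bdd_above_subspace_dual assms(2)) (auto intro: subspace_scale)
    then show ?thesis using False by (simp add: scale abs_mult field_simps)
  qed
qed

text \<open>Reflexivity of \<open>Y\<close> is moved to the range of \<open>P\<close>. Pulling
  functionals on \<open>Y\<close> back along \<open>S\<close> turns \<open>H\<close> into an element
  of the bidual of \<open>Y\<close>, hence into evaluation at some \<open>S z\<close>; testing it on
  \<open>g \<circ> U\<close>, whose pullback is \<open>g \<circ> P\<close>, gives the claim.\<close>

lemma reflexive_representation:
  fixes P :: "'a::real_normed_vector \<Rightarrow>\<^sub>L 'b::real_normed_vector"
    and S :: "'a \<Rightarrow>\<^sub>L 'c::real_normed_vector"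
    and H :: "('a \<Rightarrow>\<^sub>L real) \<Rightarrow>\<^sub>L real"
  assumes Y: "subspace Y" "reflexive_subspace Y" and U: "bounded_linear_on Y U"
    and S: "range S = Y" and US: "\<And>x. U (S x) = P x"
  shows "\<exists>z. \<forall>g. H (g o\<^sub>L P) = g (P z)"
proof -
  have SY: "S x \<in> Y" for x using S by blast
  \<comment> \<open>\<open>Blinfun\<close> is meaningful only for bounded linear arguments; for
    \<open>f\<close> in the dual of \<open>Y\<close> this is what \<open>rep\<close>
    secures.\<close>
  define F where "F f = H (Blinfun (\<lambda>x. f (S x)))" for f
  have rep: "blinfun_apply (Blinfun (\<lambda>x. f (S x))) = (\<lambda>x. f (S x))"
    and bound: "norm (Blinfun (\<lambda>x. f (S x))) \<le> subspace_dual_norm Y f * norm S"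
    if f: "f \<in> subspace_dual Y" for f
  proof -
    have N: "subspace_dual_norm Y f \<ge> 0" by (rule subspace_dual_norm_nonneg[OF Y(1) f])
    have le: "\<bar>f (S x)\<bar> \<le> subspace_dual_norm Y f * norm S * norm x" for x
      using order_trans[OF subspace_dual_norm_ge[OF Y(1) f SY] mult_left_mono[OF norm_blinfun[of S x] N]]
      by (simp add: mult.assoc)
    have "bounded_linear (\<lambda>x. f (S x))"
      using f SY le by (intro bounded_linear_intro[where K = "subspace_dual_norm Y f * norm S"])
        (auto simp: blinfun.add_right blinfun.scaleR_right subspace_dual_def bounded_linear_on_def mult_ac)
    then show "blinfun_apply (Blinfun (\<lambda>x. f (S x))) = (\<lambda>x. f (S x))"
      by (rule bounded_linear_Blinfun_apply)
    then show "norm (Blinfun (\<lambda>x. f (S x))) \<le> subspace_dual_norm Y f * norm S"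
      using le N by (intro norm_blinfun_bound) auto
  qed
  have add_mem: "(\<lambda>x. f x + g x) \<in> subspace_dual Y"
    if "f \<in> subspace_dual Y" "g \<in> subspace_dual Y" for f g
  proof -
    have "\<bar>f x + g x\<bar> \<le> norm x * (subspace_dual_norm Y f + subspace_dual_norm Y g)" if "x \<in> Y" for x
      using subspace_dual_norm_ge[OF Y(1) \<open>f \<in> _\<close> that] subspace_dual_norm_ge[OF Y(1) \<open>g \<in> _\<close> that]
      by (simp add: algebra_simps abs_le_iff)
    then show ?thesis
      using that
      by (intro subspace_dualI[where K = "subspace_dual_norm Y f + subspace_dual_norm Y g"])
        (auto simp: subspace_dualD(1,3) subspace_dualD(2)[where S = Y] distrib_left)
  qed
  have scale_mem: "(\<lambda>x. c * f x) \<in> subspace_dual Y" if "f \<in> subspace_dual Y" for c f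
  proof -
    have "\<bar>c * f x\<bar> \<le> norm x * (\<bar>c\<bar> * subspace_dual_norm Y f)" if "x \<in> Y" for x
      using mult_left_mono[OF subspace_dual_norm_ge[OF Y(1) \<open>f \<in> _\<close> that], of "\<bar>c\<bar>"]
      by (simp add: abs_mult mult_ac)
    then show ?thesis
      using that by (intro subspace_dualI[where K = "\<bar>c\<bar> * subspace_dual_norm Y f"])
        (auto simp: subspace_dualD(1,3) subspace_dualD(2)[where S = Y] distrib_left)
  qed
  have "F \<in> subspace_bidual Y"
    unfolding subspace_bidual_def
  proof (intro CollectI conjI ballI allI exI)
    fix f g assume fg: "f \<in> subspace_dual Y" "g \<in> subspace_dual Y"
    have "Blinfun (\<lambda>x. f (S x) + g (S x)) = Blinfun (\<lambda>x. f (S x)) + Blinfun (\<lambda>x. g (S x))"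
      using rep[OF add_mem[OF fg]]
      by (intro blinfun_eqI) (simp add: blinfun.add_left rep fg)
    then show "F (\<lambda>x. f x + g x) = F f + F g" by (simp add: F_def blinfun.add_right)
  next
    fix c f assume f: "f \<in> subspace_dual Y"
    have "Blinfun (\<lambda>x. c * f (S x)) = c *\<^sub>R Blinfun (\<lambda>x. f (S x))"
      using rep[OF scale_mem[OF f]]
      by (intro blinfun_eqI) (simp add: blinfun.scaleR_left rep f)
    then show "F (\<lambda>x. c * f x) = c * F f" by (simp add: F_def blinfun.scaleR_right)
  next
    fix f assume f: "f \<in> subspace_dual Y"
    have "\<bar>F f\<bar> \<le> norm H * norm (Blinfun (\<lambda>x. f (S x)))"
      using norm_blinfun[of H] by (simp add: F_def)
    also have "\<dots> \<le> norm H * (subspace_dual_norm Y f * norm S)"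
      by (intro mult_left_mono bound f) simp
    finally show "\<bar>F f\<bar> \<le> subspace_dual_norm Y f * (norm H * norm S)" by (simp add: mult_ac)
  qed
  then obtain y where y: "y \<in> Y" "\<And>f. f \<in> subspace_dual Y \<Longrightarrow> F f = f y"
    using Y(2) unfolding reflexive_subspace_def by blast
  obtain z where z: "S z = y" using y(1) S by blast
  have "H (g o\<^sub>L P) = g (P z)" for g
  proof -
    \<comment> \<open>The extension by 0 outside \<open>Y\<close> is the form in which
      \<open>subspace_dual\<close> represents the functional \<open>g \<circ> U\<close> on
      \<open>Y\<close>.\<close>
    define f where "f x = (if x \<in> Y then g (U x) else 0)" for x
    obtain K where K: "\<And>x. x \<in> Y \<Longrightarrow> norm (U x) \<le> norm x * K"
      using U unfolding bounded_linear_on_def by blast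
    have "\<bar>f x\<bar> \<le> norm x * (norm g * K)" if "x \<in> Y" for x
      using order_trans[OF norm_blinfun[of g "U x"] mult_left_mono[OF K[OF that], of "norm g"]] that
      by (simp add: f_def mult_ac)
    then have f: "f \<in> subspace_dual Y"
      using U Y(1) by (intro subspace_dualI[where K = "norm g * K"])
        (auto simp: bounded_linear_on_def f_def subspace_add subspace_scale
          blinfun.add_right blinfun.scaleR_right)
    have "Blinfun (\<lambda>x. f (S x)) = g o\<^sub>L P"
      using SY by (intro blinfun_eqI)
        (simp only: rep[OF f] blinfun_apply_blinfun_compose, simp add: f_def US)
    then have "H (g o\<^sub>L P) = F f" by (simp add: F_def)
    also have "\<dots> = g (P z)" using y(2)[OF f] y(1) z US[of z] by (simp add: f_def)
    finally show ?thesis .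
  qed
  then show ?thesis by blast
qed

section \<open>The twisted annihilator\<close>

lemmas blinfun_compose_left =
  bounded_bilinear.add_left[OF bounded_bilinear_blinfun_compose]
  bounded_bilinear.scaleR_left[OF bounded_bilinear_blinfun_compose]

text \<open>
  Here \<open>P\<close> is a projection of the space onto \<open>Z\<close> and \<open>S = T \<circ> P\<close> for an isomorphism
  \<open>T\<close> of \<open>Z\<close> onto \<open>Y\<close>; the last assumption is the reflexivity of \<open>Z\<close>, whose dual is
  identified with the functionals satisfying \<open>g \<circ> P = g\<close>.
\<close>

locale reflexive_copy =
  fixes P :: "'a::banach \<Rightarrow>\<^sub>L 'a" and S :: "'a \<Rightarrow>\<^sub>L (('a \<Rightarrow>\<^sub>L real) \<Rightarrow>\<^sub>L real)" and \<delta> K :: real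
  assumes P_idem [simp]: "\<And>x. P (P x) = P x"
    and S_P [simp]: "\<And>x. S (P x) = S x"
    and \<delta>_pos: "\<delta> > 0"
    and inclined: "\<And>x y. \<delta> * norm (S x) \<le> norm (S x - canonical_embedding y)"
    and K_nonneg: "K \<ge> 0"
    and bounded_below: "\<And>x. norm (P x) \<le> K * norm (S x)"
    and represent: "\<And>H :: ('a \<Rightarrow>\<^sub>L real) \<Rightarrow>\<^sub>L real. \<exists>z. \<forall>g. blinfun_apply H (g o\<^sub>L P) = g (P z)"
begin

definition twisted_annihilator :: "('a \<Rightarrow>\<^sub>L real) set" where
  "twisted_annihilator = {f. \<forall>x. blinfun_apply (S x) f = f (P x)}"

lemma closed_subspace_twisted_annihilator: "closed_subspace twisted_annihilator"
proof -
  have "subspace twisted_annihilator"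
    by (auto simp: subspace_def twisted_annihilator_def
        blinfun.add_right blinfun.add_left blinfun.scaleR_right blinfun.scaleR_left)
  moreover have "closed twisted_annihilator"
    unfolding twisted_annihilator_def by (intro closed_Collect_all closed_Collect_eq continuous_intros)
  ultimately show ?thesis by (simp add: closed_subspace_def)
qed

text \<open>The functional \<open>z \<mapsto> (T z - z) f\<close> on \<open>Z\<close>, pulled back
  along \<open>P\<close>. The kernel of \<open>defect\<close> is
  \<open>twisted_annihilator\<close>.\<close>

definition defect :: "('a \<Rightarrow>\<^sub>L real) \<Rightarrow> ('a \<Rightarrow>\<^sub>L real)" where
  "defect f = Blinfun (\<lambda>x. S x f - f (P x))"

lemma defect_apply: "blinfun_apply (defect f) x = S x f - f (P x)"
  unfolding defect_def by (subst bounded_linear_Blinfun_apply) (auto intro!: bounded_linear_intros)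

lemma bounded_linear_defect: "bounded_linear defect"
proof (rule bounded_linear_intro[where K = "norm S + norm P"])
  show "defect (f + g) = defect f + defect g" for f g
    by (intro blinfun_eqI) (simp add: defect_apply blinfun.add_left blinfun.add_right)
  show "defect (r *\<^sub>R f) = r *\<^sub>R defect f" for r f
    by (intro blinfun_eqI) (simp add: defect_apply blinfun.scaleR_left blinfun.scaleR_right algebra_simps)
  show "norm (defect f) \<le> norm f * (norm S + norm P)" for f
  proof (rule norm_blinfun_bound)
    fix x
    have "norm (S x f) \<le> norm S * norm x * norm f"
      by (rule order_trans[OF norm_blinfun mult_right_mono[OF norm_blinfun]]) simp
    moreover have "norm (f (P x)) \<le> norm f * (norm P * norm x)"
      by (rule order_trans[OF norm_blinfun mult_left_mono[OF norm_blinfun]]) simp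
    ultimately have "norm (S x f - f (P x)) \<le> norm S * norm x * norm f + norm f * (norm P * norm x)"
      using norm_triangle_ineq4[of "S x f" "f (P x)"] by linarith
    then show "norm (defect f x) \<le> norm f * (norm S + norm P) * norm x"
      by (simp add: defect_apply algebra_simps)
  qed simp
qed

text \<open>The operator \<open>f \<mapsto> (defect f, f x)\<close> maps onto a copy of the dual of
  \<open>Z\<close> times the reals, with constants independent of \<open>x\<close>. A preimage of
  \<open>(0, 1)\<close> has no defect and takes the value 1 at \<open>x\<close>.\<close>

lemma ex_peaking_functional:
  assumes x: "norm x = 1"
  shows "\<exists>f\<in>twisted_annihilator. blinfun_apply f x = 1 \<and> norm f \<le> 4 * (1 + (1 + 2 * K) / \<delta>)"
proof -
  define C where "C = 1 + (1 + 2 * K) / \<delta>"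
  have C: "C > 0" using \<delta>_pos K_nonneg by (simp add: C_def add_pos_nonneg)
  have "bounded_linear (\<lambda>f. (defect f, blinfun_apply f x))"
    by (intro bounded_linear_Pair bounded_linear_defect blinfun.bounded_linear_left)
  then have \<Psi>: "blinfun_apply (Blinfun (\<lambda>f. (defect f, blinfun_apply f x))) =
      (\<lambda>f. (defect f, blinfun_apply f x))"
    by (rule bounded_linear_Blinfun_apply)
  define \<Psi> where "\<Psi> = Blinfun (\<lambda>f. (defect f, blinfun_apply f x))"
  note \<Psi> = \<Psi>[folded \<Psi>_def]
  \<comment> \<open>The condition \<open>g \<circ> P = g\<close> singles out the copy of the dual of
    \<open>Z\<close> in the dual of the space.\<close>
  define E where "E = {(g :: 'a \<Rightarrow>\<^sub>L real, t :: real). g o\<^sub>L P = g}"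
  have E: "subspace E"
    by (auto simp: E_def subspace_def zero_prod_def blinfun_compose_left)
  have defect_P: "defect f o\<^sub>L P = defect f" for f
    by (intro blinfun_eqI) (simp add: defect_apply)
  then have range: "range \<Psi> \<subseteq> E" by (auto simp: \<Psi> E_def)
  have key: "\<bar>blinfun_apply h g\<bar> \<le> C * norm (h o\<^sub>L \<Psi>) * norm g"
    if gE: "g \<in> E" for h :: "(('a \<Rightarrow>\<^sub>L real) \<times> real) \<Rightarrow>\<^sub>L real" and g
  proof -
    have "bounded_linear (\<lambda>g :: 'a \<Rightarrow>\<^sub>L real. blinfun_apply h (g, 0))"
      by (intro bounded_linear_compose[OF blinfun.bounded_linear_right] bounded_linear_Pair
          bounded_linear_ident bounded_linear_zero)
    \<comment> \<open>By reflexivity the first component of \<open>h\<close> acts on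
      \<open>E\<close> as evaluation at \<open>P z\<close>, so \<open>h\<close> is described by the
      pair of \<open>P z\<close> and the scalar \<open>s\<close>.\<close>
    then obtain z where z: "\<And>g. blinfun_apply h (g o\<^sub>L P, 0) = g (P z)"
      using represent[of "Blinfun (\<lambda>g. blinfun_apply h (g, 0))"]
      by (auto simp: bounded_linear_Blinfun_apply)
    define s where "s = h (0, 1)"
    have h_eq: "h (g, t) = blinfun_apply g (P z) + t * s" if "g o\<^sub>L P = g" for g t
    proof -
      have "(g, t) = (g o\<^sub>L P, 0) + t *\<^sub>R (0, 1)" using that by simp
      then show ?thesis
        by (simp only: blinfun.add_right blinfun.scaleR_right z s_def real_scaleR_def)
    qed
    define N where "N = norm (h o\<^sub>L \<Psi>)"
    \<comment> \<open>As an element of the bidual, \<open>h \<circ> \<Psi>\<close> is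
      \<open>S z\<close> minus a vector of the space. The inclination therefore bounds
      \<open>S z\<close> by \<open>N / \<delta>\<close>, and \<open>P z\<close> and \<open>s\<close>
      follow.\<close>
    have "norm (S z - canonical_embedding (P z - s *\<^sub>R x)) \<le> N"
    proof (rule norm_blinfun_bound)
      fix f :: "'a \<Rightarrow>\<^sub>L real"
      have "(S z - canonical_embedding (P z - s *\<^sub>R x)) f = (h o\<^sub>L \<Psi>) f"
        by (simp add: \<Psi> h_eq[OF defect_P] defect_apply canonical_embedding.rep_eq blinfun.diff_left
            blinfun.diff_right blinfun.scaleR_right)
      then show "norm ((S z - canonical_embedding (P z - s *\<^sub>R x)) f) \<le> N * norm f"
        using norm_blinfun[of "h o\<^sub>L \<Psi>" f] by (simp add: N_def)
    qed (simp add: N_def)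
    note le_N = this
    have "\<delta> * norm (S z) \<le> N" using inclined le_N by (rule order_trans)
    then have Sz: "norm (S z) \<le> N / \<delta>" using \<delta>_pos by (simp add: field_simps)
    have Pz: "norm (P z) \<le> K * (N / \<delta>)"
      using order_trans[OF bounded_below mult_left_mono[OF Sz K_nonneg]] .
    have "norm (P z - s *\<^sub>R x) \<le> N + norm (S z)"
      using le_N norm_triangle_ineq2[of "canonical_embedding (P z - s *\<^sub>R x)" "S z"]
      by (simp add: norm_minus_commute)
    then have "\<bar>s\<bar> \<le> N + norm (S z) + norm (P z)"
      using norm_triangle_ineq2[of "s *\<^sub>R x" "P z"] x by (simp add: norm_minus_commute)
    \<comment> \<open>The term \<open>K * (N / \<delta>)\<close> is counted twice: once for
      \<open>P z\<close> itself and once inside the bound for \<open>s\<close>. This accounts for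
      \<open>C\<close>.\<close>
    with Sz Pz have "norm (P z) + \<bar>s\<bar> \<le> N + N / \<delta> + 2 * (K * (N / \<delta>))" by simp
    also have "\<dots> = C * N" by (simp add: C_def algebra_simps add_divide_distrib)
    finally have zs: "norm (P z) + \<bar>s\<bar> \<le> C * N" .
    obtain g1 t where g: "g = (g1, t)" "g1 o\<^sub>L P = g1" using gE by (auto simp: E_def)
    have "\<bar>h g\<bar> \<le> \<bar>g1 (P z)\<bar> + \<bar>t * s\<bar>"
      by (simp add: g(1) h_eq[OF g(2)])
    also have "\<dots> \<le> norm g1 * norm (P z) + \<bar>t\<bar> * \<bar>s\<bar>"
      using norm_blinfun[of g1 "P z"] by (simp add: abs_mult)
    also have "\<dots> \<le> norm g * norm (P z) + norm g * \<bar>s\<bar>"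
      using norm_fst_le[of g1 t] norm_snd_le[of t g1] by (intro add_mono mult_right_mono) (auto simp: g)
    also have "\<dots> = norm g * (norm (P z) + \<bar>s\<bar>)" by (simp add: algebra_simps)
    also have "\<dots> \<le> norm g * (C * N)" using zs by (intro mult_left_mono) auto
    finally show ?thesis by (simp add: N_def mult_ac)
  qed
  have "(0, 1) \<in> E" by (simp add: E_def)
  from adjoint_bounded_below_imp_surjective[OF E range C this key]
  obtain f where f: "blinfun_apply \<Psi> f = (0, 1)" "norm f \<le> 4 * C * norm (0 :: 'a \<Rightarrow>\<^sub>L real, 1 :: real)"
    by blast
  have f_0: "defect f = 0" and "f x = 1" using f(1) by (auto simp: \<Psi>)
  have "S y f = f (P y)" for y using defect_apply[of f y] by (simp add: f_0)
  then have "f \<in> twisted_annihilator" by (simp add: twisted_annihilator_def)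
  with \<open>f x = 1\<close> show ?thesis using f(2) by (auto simp: C_def norm_Pair)
qed

lemma norming_twisted_annihilator:
  assumes "S \<noteq> 0"
  shows "norming twisted_annihilator"
proof -
  define C where "C = 4 * (1 + (1 + 2 * K) / \<delta>)"
  have C: "C > 0" using \<delta>_pos K_nonneg by (simp add: C_def add_pos_nonneg)
  \<comment> \<open>At \<open>x = 0\<close> the supremum still has to range over a nonempty set; a
    peaking functional at some nonzero \<open>w\<close> provides a member.\<close>
  have "\<exists>w :: 'a. w \<noteq> 0"
  proof (rule ccontr)
    assume "\<not> ?thesis"
    then have zero: "x = 0" for x :: 'a by blast
    have "S x = 0" for x by (subst zero[of x]) (rule blinfun.zero_right)
    then show False using assms by (auto intro: blinfun_eqI)
  qed
  then obtain w :: 'a where w: "w \<noteq> 0" by blast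
  have peak: "\<exists>f\<in>twisted_annihilator. blinfun_apply f x = norm x \<and> f \<noteq> 0 \<and> norm f \<le> C" if "x \<noteq> 0" for x
  proof -
    have "norm (x /\<^sub>R norm x) = 1" using that by simp
    then obtain f where f: "f \<in> twisted_annihilator" "blinfun_apply f (x /\<^sub>R norm x) = 1" "norm f \<le> C"
      using ex_peaking_functional unfolding C_def by blast
    from f(2) have "f x = norm x" using that by (simp add: blinfun.scaleR_right field_simps)
    moreover from this have "f \<noteq> 0" using that by auto
    ultimately show ?thesis using f by blast
  qed
  have bdd: "bdd_above ((\<lambda>f. \<bar>blinfun_apply f x\<bar> / norm f) ` {f \<in> twisted_annihilator. f \<noteq> 0})" for x
  proof (rule bdd_aboveI2[where M = "norm x"])
    fix f assume "f \<in> {f \<in> twisted_annihilator. f \<noteq> 0}"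
    then show "\<bar>blinfun_apply f x\<bar> / norm f \<le> norm x"
      using norm_blinfun[of f x] by (simp add: field_simps)
  qed
  have "1 / C * norm x \<le> (SUP f\<in>{f \<in> twisted_annihilator. f \<noteq> 0}. \<bar>blinfun_apply f x\<bar> / norm f)" for x
  proof (cases "x = 0")
    case True
    obtain f where "f \<in> {f \<in> twisted_annihilator. f \<noteq> 0}" using peak[OF w] by blast
    from cSUP_upper[OF this bdd[of x]] show ?thesis by (simp add: True)
  next
    case False
    then obtain f where f: "f \<in> {f \<in> twisted_annihilator. f \<noteq> 0}" "blinfun_apply f x = norm x" "norm f \<le> C"
      using peak by blast
    then have "1 / C * norm x \<le> \<bar>f x\<bar> / norm f" using C by (auto intro!: divide_left_mono)
    also have "\<dots> \<le> (SUP f\<in>{f \<in> twisted_annihilator. f \<noteq> 0}. \<bar>blinfun_apply f x\<bar> / norm f)"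
      by (rule cSUP_upper[OF f(1) bdd])
    finally show ?thesis .
  qed
  moreover have "1 / C > 0" using C by simp
  ultimately show ?thesis unfolding norming_def by blast
qed

text \<open>The generalized limit of \<open>G (g \<circ> P \<circ> v n)\<close> is bounded and
  linear in \<open>g\<close>, and reflexivity represents it by a vector
  \<open>P (\<zeta> G)\<close>. The projection is
  \<open>G \<mapsto> S (P (\<zeta> G))\<close>.\<close>

lemma complemented_if_quasibasic:
  assumes "quasibasic twisted_annihilator"
  shows "complemented (range S)"
proof -
  obtain v :: "nat \<Rightarrow> 'a \<Rightarrow>\<^sub>L 'a" where lim: "\<And>x. (\<lambda>n. norm (v n x - x)) \<longlonglongrightarrow> 0"
    and vM: "\<And>n f. f o\<^sub>L v n \<in> twisted_annihilator"
    using assms unfolding quasibasic_def dual_map_def by blast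
  have v_lim: "(\<lambda>n. v n x) \<longlonglongrightarrow> x" for x
    by (rule LIM_zero_cancel[OF tendsto_norm_zero_cancel[OF lim]])
  have "bounded (range (\<lambda>n. v n x))" for x
    by (rule convergent_imp_bounded[OF v_lim])
  then obtain B where B: "\<And>n. norm (v n) \<le> B"
    by (rule uniform_boundedness) blast
  have B0: "B \<ge> 0" using order_trans[OF norm_ge_zero B] .
  obtain L :: "(nat \<Rightarrow>\<^sub>C real) \<Rightarrow> real" where L: "linear L" "\<And>s. \<bar>L s\<bar> \<le> norm s"
    "\<And>s l. apply_bcontfun s \<longlonglongrightarrow> l \<Longrightarrow> L s = l"
    by (rule generalized_limit_exists) blast
  define s where "s G g = Bcontfun (\<lambda>n. blinfun_apply G (g o\<^sub>L (P o\<^sub>L v n)))"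
    for G :: "('a \<Rightarrow>\<^sub>L real) \<Rightarrow>\<^sub>L real" and g
  have bound: "\<bar>blinfun_apply G (g o\<^sub>L (P o\<^sub>L v n))\<bar> \<le> norm G * (norm g * (norm P * B))" for G g n
  proof -
    have "norm (g o\<^sub>L (P o\<^sub>L v n)) \<le> norm g * (norm P * norm (v n))"
      by (rule order_trans[OF norm_blinfun_compose mult_left_mono[OF norm_blinfun_compose]]) simp
    also have "\<dots> \<le> norm g * (norm P * B)" using B by (intro mult_left_mono) auto
    finally have "norm (g o\<^sub>L (P o\<^sub>L v n)) \<le> norm g * (norm P * B)" .
    from order_trans[OF norm_blinfun mult_left_mono[OF this norm_ge_zero[of G]]]
    show ?thesis by simp
  qed
  have s: "apply_bcontfun (s G g) = (\<lambda>n. blinfun_apply G (g o\<^sub>L (P o\<^sub>L v n)))" for G g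
    unfolding s_def by (intro Bcontfun_inverse bcontfun_normI) (use bound in auto)
  have s_le: "norm (s G g) \<le> norm G * (norm g * (norm P * B))" for G g
    using bound by (intro norm_bound) (simp add: s)
  have s_add_left: "s (G + G') g = s G g + s G' g" for G G' g
    by (intro bcontfun_eqI) (simp add: s blinfun.add_left)
  have s_scale_left: "s (c *\<^sub>R G) g = c *\<^sub>R s G g" for G c g
    by (intro bcontfun_eqI) (simp add: s blinfun.scaleR_left)
  have s_add_right: "s G (g + g') = s G g + s G g'" for G g' g
    by (intro bcontfun_eqI) (simp add: s blinfun.add_right blinfun_compose_left)
  have s_scale_right: "s G (c *\<^sub>R g) = c *\<^sub>R s G g" for G c g
    by (intro bcontfun_eqI) (simp add: s blinfun.scaleR_right blinfun_compose_left)
  \<comment> \<open>\<open>represent\<close> describes a functional only at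
    \<open>g \<circ> P\<close>; this invariance extends the description to every
    \<open>g\<close>.\<close>
  have s_P: "s G (g o\<^sub>L P) = s G g" for G g
  proof -
    have "(g o\<^sub>L P) o\<^sub>L (P o\<^sub>L v n) = g o\<^sub>L (P o\<^sub>L v n)" for n
      by (intro blinfun_eqI) simp
    then show ?thesis by (simp add: s_def)
  qed
  have "\<exists>z. \<forall>g. L (s G g) = blinfun_apply g (P z)" for G
  proof -
    have "bounded_linear (\<lambda>g. L (s G g))"
      using order_trans[OF L(2) s_le]
      by (intro bounded_linear_intro[where K = "norm G * (norm P * B)"])
        (auto simp: s_add_right s_scale_right linear_add[OF L(1)] linear_scale[OF L(1)] mult_ac)
    then show ?thesis
      using represent[of "Blinfun (\<lambda>g. L (s G g))"] by (simp add: bounded_linear_Blinfun_apply s_P)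
  qed
  \<comment> \<open>The choice of \<open>\<zeta> G\<close> is arbitrary, and only
    \<open>P (\<zeta> G)\<close> is determined; linearity is therefore proved for
    \<open>P \<circ> \<zeta>\<close>.\<close>
  then obtain \<zeta> where \<zeta>: "\<And>G g. L (s G g) = blinfun_apply g (P (\<zeta> G))" by metis
  have P_add: "P (\<zeta> (G + G')) = P (\<zeta> G) + P (\<zeta> G')" for G G'
    by (rule functionals_separate)
      (simp add: blinfun.add_right s_add_left linear_add[OF L(1)] flip: \<zeta>)
  have P_scale: "P (\<zeta> (c *\<^sub>R G)) = c *\<^sub>R P (\<zeta> G)" for c G
    by (rule functionals_separate)
      (simp add: blinfun.scaleR_right s_scale_left linear_scale[OF L(1)] flip: \<zeta>)
  have P_le: "norm (P (\<zeta> G)) \<le> norm G * (norm P * B)" for G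
  proof -
    obtain h :: "'a \<Rightarrow>\<^sub>L real" where h: "norm h \<le> 1" "h (P (\<zeta> G)) = norm (P (\<zeta> G))"
      by (rule norming_functional)
    have "norm (P (\<zeta> G)) \<le> norm G * (norm h * (norm P * B))"
      using order_trans[OF L(2) s_le, of G h] h(2) by (simp add: \<zeta>)
    also have "\<dots> \<le> norm G * (1 * (norm P * B))"
      using h(1) B0 by (intro mult_left_mono mult_right_mono) auto
    finally show ?thesis by simp
  qed
  \<comment> \<open>Since \<open>g \<circ> P \<circ> v n\<close> lies in
    \<open>twisted_annihilator\<close>, the bidual element \<open>S x\<close> acts on it as
    evaluation at \<open>P x\<close>. The sequence then converges by the approximation property of
    \<open>v\<close>, and \<open>L\<close> returns its ordinary limit.\<close>
  have P_S: "P (\<zeta> (S x)) = P x" for x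
  proof (rule functionals_separate)
    fix g :: "'a \<Rightarrow>\<^sub>L real"
    have "S x (g o\<^sub>L (P o\<^sub>L v n)) = g (P (v n (P x)))" for n
    proof -
      have "(g o\<^sub>L P) o\<^sub>L v n = g o\<^sub>L (P o\<^sub>L v n)" by (intro blinfun_eqI) simp
      then show ?thesis using vM[of "g o\<^sub>L P" n] by (simp add: twisted_annihilator_def)
    qed
    then have "apply_bcontfun (s (S x) g) \<longlonglongrightarrow> g (P (P x))"
      unfolding s by (simp only:) (intro tendsto_intros v_lim)
    then show "g (P (\<zeta> (S x))) = g (P x)" using L(3) by (simp flip: \<zeta>)
  qed
  have Q: "bounded_linear (\<lambda>G. S (P (\<zeta> G)))"
  proof (rule bounded_linear_compose[OF blinfun.bounded_linear_right])
    show "bounded_linear (\<lambda>G. P (\<zeta> G))"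
      using P_add P_scale P_le by (rule bounded_linear_intro)
  qed
  define Q where "Q = Blinfun (\<lambda>G. S (P (\<zeta> G)))"
  have Q_apply: "Q G = S (\<zeta> G)" for G
    using bounded_linear_Blinfun_apply[OF Q] by (simp add: Q_def)
  have Q_S: "Q (S x) = S x" for x
    using P_S[of x] by (metis Q_apply S_P)
  have "Q (Q G) = Q G" for G
    unfolding Q_apply[of G] by (rule Q_S)
  then have "Q o\<^sub>L Q = Q" by (intro blinfun_eqI[of "Q o\<^sub>L Q"]) simp
  moreover have "range Q = range S"
  proof
    show "range Q \<subseteq> range S" by (auto simp: Q_apply)
    show "range S \<subseteq> range Q" by (rule image_subsetI) (metis Q_S rangeI)
  qed
  ultimately show ?thesis unfolding complemented_def by blast
qed

end

section \<open>Passage from the subspaces \<open>Y\<close> and \<open>Z\<close> to the operators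
  \<open>P\<close> and \<open>S\<close>\<close>

theorem theorem3:
  fixes Y :: "(('a::banach \<Rightarrow>\<^sub>L real) \<Rightarrow>\<^sub>L real) set"
    and Z :: "'a set"
  assumes "closed_subspace Y" and "reflexive_subspace Y" and "\<not> complemented Y"
    and "closed_subspace Z" and "complemented Z"
    and "isomorphic_subspaces Y Z"
    and "inclination Y (range canonical_embedding) > 0"
  shows "\<not> TPBA TYPE('a)"
proof
  assume tpba: "TPBA TYPE('a)"
  have Y: "subspace Y" using assms(1) by (simp add: closed_subspace_def)
  obtain P :: "'a \<Rightarrow>\<^sub>L 'a" where P: "P o\<^sub>L P = P" "range P = Z"
    using assms(5) unfolding complemented_def by blast
  have PP: "P (P x) = P x" for x using P(1) by (metis blinfun_apply_blinfun_compose)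
  obtain U where U: "bij_betw U Y Z" "bounded_linear_on Y U" "bounded_linear_on Z (inv_into Y U)"
    using assms(6) unfolding isomorphic_subspaces_def by blast
  define T where "T = inv_into Y U"
  obtain KT where KT: "\<And>x. x \<in> Z \<Longrightarrow> norm (T x) \<le> norm x * KT"
    using U(3) unfolding bounded_linear_on_def T_def by blast
  obtain KU where KU: "\<And>y. y \<in> Y \<Longrightarrow> norm (U y) \<le> norm y * KU"
    using U(2) unfolding bounded_linear_on_def by blast
  have PZ: "P x \<in> Z" for x using P(2) by blast
  have "norm (T (P x)) \<le> norm x * (norm P * \<bar>KT\<bar>)" for x
  proof -
    have "norm (T (P x)) \<le> norm (P x) * \<bar>KT\<bar>"
      using KT[OF PZ] by (rule order_trans) (simp add: mult_left_mono)
    also have "\<dots> \<le> norm P * norm x * \<bar>KT\<bar>" by (intro mult_right_mono norm_blinfun) simp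
    finally show ?thesis by (simp add: mult_ac)
  qed
  then have "bounded_linear (\<lambda>x. T (P x))"
    using U(3) PZ by (intro bounded_linear_intro)
      (auto simp: bounded_linear_on_def T_def blinfun.add_right blinfun.scaleR_right)
  then have S: "blinfun_apply (Blinfun (\<lambda>x. T (P x))) = (\<lambda>x. T (P x))"
    by (rule bounded_linear_Blinfun_apply)
  \<comment> \<open>The isomorphism \<open>T\<close> is controlled only on \<open>Z\<close>;
    composing it with the projection gives a bounded operator on the whole space with range
    \<open>Y\<close>.\<close>
  define S where "S = Blinfun (\<lambda>x. T (P x))"
  note S = S[folded S_def]
  have TZ: "T ` Z = Y" using U(1) unfolding T_def by (metis bij_betw_imp_surj_on bij_betw_inv_into)
  have rangeS: "range S = Y" unfolding S using TZ P(2) image_image[of T P UNIV] by simp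
  have US: "U (S x) = P x" for x
    using U(1) PZ unfolding S T_def by (simp add: bij_betw_inv_into_right[OF U(1)])
  have emb: "subspace (range canonical_embedding)"
    by (intro linear_subspace_image linear_canonical_embedding subspace_UNIV)
  interpret reflexive_copy P S "inclination Y (range canonical_embedding)" "\<bar>KU\<bar>"
  proof
    show "\<exists>z. \<forall>g. blinfun_apply H (g o\<^sub>L P) = g (P z)" for H :: "('a \<Rightarrow>\<^sub>L real) \<Rightarrow>\<^sub>L real"
      by (rule reflexive_representation[OF Y assms(2) U(2) rangeS US])
    show "inclination Y (range canonical_embedding) * norm (S x) \<le> norm (S x - canonical_embedding y)" for x y
      using rangeS by (intro inclination_le Y emb) auto
    show "norm (P x) \<le> \<bar>KU\<bar> * norm (S x)" for x
    proof -
      have "norm (U (S x)) \<le> norm (S x) * KU" using rangeS by (intro KU) auto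
      also have "\<dots> \<le> norm (S x) * \<bar>KU\<bar>" by (simp add: mult_left_mono)
      finally show ?thesis by (simp add: US mult.commute)
    qed
  qed (simp_all add: PP S assms(7))
  \<comment> \<open>Otherwise \<open>Y\<close> would be the zero subspace, which the zero operator
    complements.\<close>
  have "S \<noteq> 0"
  proof
    assume "S = 0"
    then have "Y = {0}" using rangeS by (auto simp flip: rangeS)
    then have "complemented Y" unfolding complemented_def by (intro exI[of _ 0]) auto
    then show False using assms(3) by blast
  qed
  then have "quasibasic twisted_annihilator"
    using tpba closed_subspace_twisted_annihilator norming_twisted_annihilator
    unfolding TPBA_def by blast
  then show False using complemented_if_quasibasic assms(3) rangeS by blast
qed

end
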